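(* For any integers $2\leq s\leq t$, there exists a constant $C$ such that, letting $H_{s,t}$ be the subdivision of the complete bipartite graph $K_{s,t}$, we have $\mathrm{ex}(n,H_{s,t})\leq Cn^{3/2-1/(12t)}$ for all $n$.
   Context: The subdivision of a graph $F$ is the graph obtained from $F$ by replacing each edge by a path of length $2$, the new middle vertices being distinct for distinct edges. $\mathrm{ex}(n,H)$ is the largest number of edges in an $n$-vertex graph containing no copy of $H$. *)

theory Defs
  imports Complex_Main
begin

record 'a graph =
  verts :: "'a set"
  edges :: "'a set set"

definition finite_simple_graph :: "'a graph \<Rightarrow> bool" where
  "finite_simple_graph G \<longleftrightarrow>
     finite (verts G) \<and> (\<forall>e \<in> edges G. e \<subseteq> verts G \<and> card e = 2)"

(* A copy of H in G is a subgraph of G, not necessarily induced, isomorphic to H. *)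
definition contains_copy :: "'a graph \<Rightarrow> 'b graph \<Rightarrow> bool" where
  "contains_copy G H \<longleftrightarrow>
     (\<exists>f. inj_on f (verts H) \<and> f ` verts H \<subseteq> verts G \<and> (\<forall>e \<in> edges H. f ` e \<in> edges G))"

(* Vertices are taken in nat, which up to isomorphism covers all n-vertex graphs.
   Max is applied to a finite set, which is nonempty as soon as H has an edge. *)
definition ex_number :: "nat \<Rightarrow> 'b graph \<Rightarrow> nat" where
  "ex_number n H = Max {card (edges G) | G :: nat graph.
     finite_simple_graph G \<and> card (verts G) = n \<and> \<not> contains_copy G H}"

definition complete_bipartite :: "nat \<Rightarrow> nat \<Rightarrow> (nat + nat) graph" where
  "complete_bipartite s t =
     \<lparr> verts = Inl ` {..<s} \<union> Inr ` {..<t},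
       edges = {{Inl i, Inr j} | i j. i < s \<and> j < t} \<rparr>"

(* The middle vertex of the path replacing the edge e is Inr e. *)
definition subdivision :: "'a graph \<Rightarrow> ('a + 'a set) graph" where
  "subdivision F =
     \<lparr> verts = Inl ` verts F \<union> Inr ` edges F,
       edges = {{Inl v, Inr e} | v e. e \<in> edges F \<and> v \<in> e} \<rparr>"

lemma finite_edges:
  assumes "finite_simple_graph G"
  shows "finite (edges G)"
  using assms finite_subset[of "edges G" "Pow (verts G)"]
  by (auto simp: finite_simple_graph_def)

lemma finite_simple_graph_complete_bipartite:
  "finite_simple_graph (complete_bipartite s t)"
  by (auto simp: finite_simple_graph_def complete_bipartite_def)

lemma finite_simple_graph_subdivision:
  "finite_simple_graph F \<Longrightarrow> finite_simple_graph (subdivision F)"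
  using finite_edges[of F] by (auto simp: finite_simple_graph_def subdivision_def)

lemma finite_ex_number_set:
  "finite {card (edges G) | G :: nat graph.
     finite_simple_graph G \<and> card (verts G) = n \<and> \<not> contains_copy G H}"
proof (rule finite_subset)
  show "{card (edges G) | G :: nat graph.
     finite_simple_graph G \<and> card (verts G) = n \<and> \<not> contains_copy G H} \<subseteq> {..2 ^ n}"
  proof clarify
    fix G :: "nat graph" assume "finite_simple_graph G"
    then show "card (edges G) \<le> 2 ^ card (verts G)"
      using card_mono[of "Pow (verts G)" "edges G"]
      by (auto simp: finite_simple_graph_def card_Pow)
  qed
qed simp

lemma ex_number_set_nonempty:
  assumes "edges H \<noteq> {}"
  shows "{card (edges G) | G :: nat graph.
     finite_simple_graph G \<and> card (verts G) = n \<and> \<not> contains_copy G H} \<noteq> {}"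
proof -
  have "finite_simple_graph \<lparr> verts = {..<n}, edges = {} \<rparr>
      \<and> card (verts \<lparr> verts = {..<n}, edges = {} \<rparr>) = n
      \<and> \<not> contains_copy \<lparr> verts = {..<n}, edges = {} \<rparr> H"
    using assms by (auto simp: finite_simple_graph_def contains_copy_def)
  then show ?thesis by blast
qed

end

theory Submission
  imports Defs
begin

text \<open>
  After passing to a bipartite subgraph with parts \<open>A\<close>, \<open>B\<close> in which all degrees in \<open>B\<close> lie in
  \<open>[D, 2D]\<close> (a large cut, then a dyadic class of degrees, at the cost of a factor \<open>log n\<close>), call a
  pair in \<open>A\<close> light if its codegree is positive but less than \<open>st\<close>, and heavy if its codegree is
  at least \<open>st\<close>. Heavy pairs cannot form a clique of size \<open>s + t\<close>, since the middle vertices could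
  then be chosen greedily. So a positive proportion of the pairs in each neighbourhood of a vertex
  of \<open>B\<close> is light, and as light pairs have bounded codegree, there are many of them in total. In the
  graph of light pairs, \<open>y_1, ..., y_s\<close> are chosen one by one, each keeping a large set of common
  light neighbours; any chosen light pair rules out at most \<open>2Dst\<close> further vertices through shared
  middle vertices. The set of common neighbours that survives is much larger than \<open>D\<close>, hence
  \<open>x_1, ..., x_t\<close> can be chosen from it greedily with all middle vertices distinct.
\<close>

section \<open>Codegrees, light pairs and grids\<close>

text \<open>A bipartite graph is encoded by one side \<open>B\<close> and the neighbourhoods
  \<open>N b\<close> in the other side, so this set holds the candidates for the middle vertex
  between \<open>u\<close> and \<open>v\<close>.\<close>

definition common :: "'b set \<Rightarrow> ('b \<Rightarrow> 'a set) \<Rightarrow> 'a \<Rightarrow> 'a \<Rightarrow> 'b set" where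
  "common B N u v = {b \<in> B. u \<in> N b \<and> v \<in> N b}"

definition light :: "'b set \<Rightarrow> ('b \<Rightarrow> 'a set) \<Rightarrow> nat \<Rightarrow> 'a \<Rightarrow> 'a \<Rightarrow> bool" where
  "light B N h u v \<longleftrightarrow> u \<noteq> v \<and> common B N u v \<noteq> {} \<and> card (common B N u v) < h"

text \<open>The subdivision of \<open>complete_bipartite s t\<close> with all branch vertices
  \<open>y j\<close>, \<open>x k\<close> on the side opposite \<open>B\<close> and the middle
  vertices \<open>m (j, k)\<close> in \<open>B\<close>.\<close>

definition linked_grid :: "'b set \<Rightarrow> ('b \<Rightarrow> 'a set) \<Rightarrow> nat \<Rightarrow> nat \<Rightarrow> bool" where
  "linked_grid B N s t \<longleftrightarrow>
     (\<exists>y x m. inj_on y {..<s} \<and> inj_on x {..<t} \<and> y ` {..<s} \<inter> x ` {..<t} = {} \<and>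
        inj_on m ({..<s} \<times> {..<t}) \<and> (\<forall>j<s. \<forall>k<t. m (j, k) \<in> common B N (y j) (x k)))"

lemma common_commute: "common B N u v = common B N v u"
  by (auto simp: common_def)

lemma light_commute: "light B N h u v \<longleftrightarrow> light B N h v u"
  by (auto simp: light_def common_commute[of B N u v])

lemma finite_common: "finite B \<Longrightarrow> finite (common B N u v)"
  by (auto simp: common_def)

section \<open>Heavy cliques and the number of light pairs\<close>

lemma distinct_representatives:
  fixes S :: "'i \<Rightarrow> 'b set"
  assumes "finite I" "\<And>i. i \<in> I \<Longrightarrow> card I \<le> card (S i)"
  shows "\<exists>m. inj_on m I \<and> (\<forall>i\<in>I. m i \<in> S i)"
  using assms
proof (induction I rule: finite_induct)
  case empty
  then show ?case by simp
next
  case (insert i I)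
  have "\<And>j. j \<in> I \<Longrightarrow> card I \<le> card (S j)"
    using insert.prems insert.hyps by (metis card_insert_disjoint insertCI Suc_leD)
  then obtain m where m: "inj_on m I" "\<forall>j\<in>I. m j \<in> S j"
    using insert.IH by blast
  have "card (m ` I) < card (S i)"
    using insert.prems[of i] insert.hyps card_image_le[of I m] by simp
  then have "\<not> S i \<subseteq> m ` I"
    using insert.hyps(1) by (meson card_mono finite_imageI not_less)
  then obtain b where b: "b \<in> S i" "b \<notin> m ` I" by blast
  have "inj_on (m(i := b)) (insert i I)"
    using m(1) b(2) insert.hyps(2) by (auto simp: inj_on_def)
  moreover have "\<forall>j\<in>insert i I. (m(i := b)) j \<in> S j"
    using m(2) b(1) by auto
  ultimately show ?case by blast
qed

text \<open>Any split of the clique into \<open>s\<close> and \<open>t\<close> vertices works: the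
  \<open>s * t\<close> pairs across have at least \<open>s * t\<close> candidates each, so
  \<open>distinct_representatives\<close> supplies the middle vertices.\<close>

lemma linked_grid_if_heavy_clique:
  assumes "finite X" "card X = s + t"
    and heavy: "\<And>u v. u \<in> X \<Longrightarrow> v \<in> X \<Longrightarrow> u \<noteq> v \<Longrightarrow> s * t \<le> card (common B N u v)"
  shows "linked_grid B N s t"
proof -
  obtain f where f: "bij_betw f {..<s + t} X"
    using ex_bij_betw_nat_finite[OF assms(1)] assms(2) by (metis lessThan_atLeast0)
  define y where "y = f"
  define x where "x = (\<lambda>k. f (s + k))"
  have inj: "inj_on f {..<s + t}" and im: "f ` {..<s + t} = X"
    using f by (auto simp: bij_betw_def)
  have y: "inj_on y {..<s}"
    unfolding y_def using inj by (rule inj_on_subset) auto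
  have x: "inj_on x {..<t}"
  proof (rule inj_onI)
    fix k k' assume "k \<in> {..<t}" "k' \<in> {..<t}" "x k = x k'"
    then show "k = k'" using inj_onD[OF inj, of "s + k" "s + k'"] by (simp add: x_def)
  qed
  have ne: "y j \<noteq> x k" if "j < s" "k < t" for j k
    unfolding x_def y_def using inj_onD[OF inj, of j "s + k"] that by auto
  have "\<exists>m. inj_on m ({..<s} \<times> {..<t}) \<and>
      (\<forall>p\<in>{..<s} \<times> {..<t}. m p \<in> common B N (y (fst p)) (x (snd p)))"
  proof (rule distinct_representatives)
    fix p assume p: "p \<in> {..<s} \<times> {..<t}"
    then have "y (fst p) \<in> X" "x (snd p) \<in> X"
      unfolding x_def y_def im[symmetric] by auto
    then show "card ({..<s} \<times> {..<t}) \<le> card (common B N (y (fst p)) (x (snd p)))"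
      using heavy ne p by auto
  qed simp
  then obtain m where "inj_on m ({..<s} \<times> {..<t})"
      "\<forall>p\<in>{..<s} \<times> {..<t}. m p \<in> common B N (y (fst p)) (x (snd p))" by blast
  then show ?thesis
    unfolding linked_grid_def using x y ne
    by (intro exI[of _ y] exI[of _ x] exI[of _ m]) auto
qed

text \<open>If some \<open>w\<close> is related to at most half of \<open>S\<close>, the induction continues in the set of elements
  unrelated to \<open>w\<close>; otherwise at least half of all pairs are related.\<close>
lemma many_related_pairs:
  fixes R :: "'a \<Rightarrow> 'a \<Rightarrow> bool"
  assumes "finite S" and sym: "\<And>u v. R u v \<Longrightarrow> R v u" and refl: "\<And>u. R u u"
    and "\<And>X. X \<subseteq> S \<Longrightarrow> card X = r \<Longrightarrow> \<exists>u\<in>X. \<exists>v\<in>X. u \<noteq> v \<and> R u v"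
  shows "(card S)\<^sup>2 \<le> 4 ^ r * card {(u, v) \<in> S \<times> S. R u v}"
  using assms(1,4)
proof (induction r arbitrary: S)
  case 0
  then have False using "0.prems"(2)[of "{}"] by auto
  then show ?case ..
next
  case (Suc r)
  define P where "P = {(u, v) \<in> S \<times> S. R u v}"
  have finP: "finite P" unfolding P_def using Suc.prems(1) by (auto intro: finite_subset[of _ "S \<times> S"])
  show ?case
  proof (cases "\<exists>w\<in>S. 2 * card {v \<in> S. R w v} \<le> card S")
    case True
    then obtain w where w: "w \<in> S" "2 * card {v \<in> S. R w v} \<le> card S" by blast
    define T where "T = S - {v \<in> S. R w v}"
    have cT: "card S \<le> 2 * card T"
      using w(2) Suc.prems(1) card_Diff_subset[of "{v \<in> S. R w v}" S]
      unfolding T_def by auto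
    have "(card T)\<^sup>2 \<le> 4 ^ r * card {(u, v) \<in> T \<times> T. R u v}"
    proof (rule Suc.IH)
      show "finite T" using Suc.prems(1) by (simp add: T_def)
      fix X assume X: "X \<subseteq> T" "card X = r"
      have "w \<notin> X" using X(1) refl by (auto simp: T_def w(1))
      moreover have "finite X" using X(1) \<open>finite T\<close> finite_subset by blast
      ultimately have "card (insert w X) = Suc r" using X(2) by simp
      moreover have "insert w X \<subseteq> S" using X(1) w(1) by (auto simp: T_def)
      ultimately obtain u v where uv: "u \<in> insert w X" "v \<in> insert w X" "u \<noteq> v" "R u v"
        using Suc.prems(2) by blast
      have "u \<noteq> w" "v \<noteq> w"
        using uv X(1) sym by (auto simp: T_def)
      then show "\<exists>u\<in>X. \<exists>v\<in>X. u \<noteq> v \<and> R u v" using uv by blast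
    qed
    also have "\<dots> \<le> 4 ^ r * card P"
      by (intro mult_left_mono card_mono finP) (auto simp: P_def T_def)
    finally have "4 * (card T)\<^sup>2 \<le> 4 ^ Suc r * card P" by simp
    moreover have "(card S)\<^sup>2 \<le> (2 * card T)\<^sup>2" using cT by (rule power_mono) simp
    ultimately show ?thesis unfolding P_def by (simp add: power_mult_distrib)
  next
    case False
    have "P = (SIGMA u:S. {v \<in> S. R u v})" by (auto simp: P_def)
    then have "card P = (\<Sum>u\<in>S. card {v \<in> S. R u v})"
      using Suc.prems(1) by (simp add: card_SigmaI)
    moreover have "(\<Sum>u\<in>S. card S) \<le> (\<Sum>u\<in>S. 2 * card {v \<in> S. R u v})"
      using False by (intro sum_mono) force
    ultimately have "(card S)\<^sup>2 \<le> 2 * card P"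
      by (simp add: power2_eq_square sum_distrib_left)
    also have "\<dots> \<le> 4 ^ Suc r * card P"
      using one_le_power[of "4::nat" r] by simp
    finally show ?thesis unfolding P_def .
  qed
qed

text \<open>Light pairs are double counted by the neighbourhoods containing them. Without a heavy
  clique, \<open>many_related_pairs\<close> makes a proportion of order
  \<open>1 / 4 ^ (s + t)\<close> of the pairs in every \<open>N b\<close> light, whereas a light
  pair lies in fewer than \<open>s * t\<close> neighbourhoods.\<close>

lemma card_light_pairs_ge:
  fixes N :: "'b \<Rightarrow> 'a set"
  assumes "finite A" "finite B" and NA: "\<And>b. b \<in> B \<Longrightarrow> N b \<subseteq> A"
    and D: "\<And>b. b \<in> B \<Longrightarrow> D \<le> card (N b)" "2 * 4 ^ (s + t) \<le> D"
    and no: "\<not> linked_grid B N s t"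
  shows "card B * D\<^sup>2 \<le> 2 * 4 ^ (s + t) * (s * t) * card {(u, v) \<in> A \<times> A. light B N (s * t) u v}"
proof -
  define L where "L = {(u, v) \<in> A \<times> A. light B N (s * t) u v}"
  define Lb where "Lb = (\<lambda>b. {(u, v) \<in> N b \<times> N b. light B N (s * t) u v})"
  have fL: "finite L" unfolding L_def using assms(1) by (auto intro: finite_subset[of _ "A \<times> A"])
  have one: "D\<^sup>2 \<le> 2 * 4 ^ (s + t) * card (Lb b)" if b: "b \<in> B" for b
  proof -
    have fN: "finite (N b)" using NA[OF b] assms(1) finite_subset by blast
    \<comment> \<open>The diagonal is added because \<open>many_related_pairs\<close> needs a
      reflexive relation; a set without related pairs of distinct elements is then a heavy
      clique.\<close>
    define R where "R = (\<lambda>u v. u = v \<or> card (common B N u v) < s * t)"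
    have "(card (N b))\<^sup>2 \<le> 4 ^ (s + t) * card {(u, v) \<in> N b \<times> N b. R u v}"
    proof (rule many_related_pairs[OF fN])
      show "R v u" if "R u v" for u v
        using that common_commute[of B N u v] by (auto simp: R_def)
      show "R u u" for u by (simp add: R_def)
      fix X assume X: "X \<subseteq> N b" "card X = s + t"
      show "\<exists>u\<in>X. \<exists>v\<in>X. u \<noteq> v \<and> R u v"
      proof (rule ccontr)
        assume "\<not> ?thesis"
        then have "linked_grid B N s t"
          using X fN finite_subset
          by (intro linked_grid_if_heavy_clique[of X]) (auto simp: R_def not_less)
        then show False using no by simp
      qed
    qed
    \<comment> \<open>Two vertices of \<open>N b\<close> have \<open>b\<close> as a common
      neighbour, so a codegree below \<open>s * t\<close> is all that a distinct pair needs to be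
      light.\<close>
    also have "{(u, v) \<in> N b \<times> N b. R u v} \<subseteq> Lb b \<union> (\<lambda>u. (u, u)) ` N b"
      using b by (auto simp: Lb_def R_def light_def common_def)
    then have "card {(u, v) \<in> N b \<times> N b. R u v} \<le> card (Lb b \<union> (\<lambda>u. (u, u)) ` N b)"
      using fN by (intro card_mono) (auto simp: Lb_def intro: finite_subset[of _ "N b \<times> N b"])
    also have "\<dots> \<le> card (Lb b) + card (N b)"
      using card_Un_le[of "Lb b" "(\<lambda>u. (u, u)) ` N b"] card_image_le[OF fN, of "\<lambda>u. (u, u)"] by linarith
    finally have "(card (N b))\<^sup>2 \<le> 4 ^ (s + t) * card (Lb b) + 4 ^ (s + t) * card (N b)"
      by (simp add: algebra_simps)
    \<comment> \<open>The lower bound on \<open>D\<close> makes the diagonal term at most half of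
      \<open>(card (N b))\<^sup>2\<close>, so that it can be absorbed.\<close>
    moreover have "2 * 4 ^ (s + t) * card (N b) \<le> (card (N b))\<^sup>2"
      unfolding power2_eq_square using D(1)[OF b] D(2) by (intro mult_right_mono) auto
    ultimately have "(card (N b))\<^sup>2 \<le> 2 * 4 ^ (s + t) * card (Lb b)" by linarith
    moreover have "D\<^sup>2 \<le> (card (N b))\<^sup>2" using D(1)[OF b] by (rule power_mono) simp
    ultimately show ?thesis by linarith
  qed
  have "(\<Sum>b\<in>B. card (Lb b)) = (\<Sum>b\<in>B. card {p \<in> L. p \<in> Lb b})"
    using NA by (intro sum.cong refl arg_cong[of _ _ card]) (auto simp: L_def Lb_def)
  also have "\<dots> = (\<Sum>p\<in>L. card {b \<in> B. p \<in> Lb b})"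
    using sum.swap_restrict[OF assms(2) fL, of "\<lambda>_ _. 1::nat" "\<lambda>b p. p \<in> Lb b"] by simp
  also have "\<dots> \<le> (\<Sum>p\<in>L. s * t)"
  proof (rule sum_mono)
    fix p assume p: "p \<in> L"
    obtain u v where uv: "p = (u, v)" by force
    have "{b \<in> B. p \<in> Lb b} \<subseteq> common B N u v" by (auto simp: uv Lb_def common_def)
    then have "card {b \<in> B. p \<in> Lb b} \<le> card (common B N u v)"
      by (intro card_mono finite_common assms)
    also have "\<dots> \<le> s * t" using p by (auto simp: uv L_def light_def)
    finally show "card {b \<in> B. p \<in> Lb b} \<le> s * t" .
  qed
  finally have *: "(\<Sum>b\<in>B. card (Lb b)) \<le> s * t * card L" by (simp add: mult.commute)
  have "card B * D\<^sup>2 = (\<Sum>b\<in>B. D\<^sup>2)" by simp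
  also have "\<dots> \<le> (\<Sum>b\<in>B. 2 * 4 ^ (s + t) * card (Lb b))" by (intro sum_mono one)
  also have "\<dots> = 2 * 4 ^ (s + t) * (\<Sum>b\<in>B. card (Lb b))" by (simp add: sum_distrib_left)
  also have "\<dots> \<le> 2 * 4 ^ (s + t) * (s * t * card L)" using * by (intro mult_left_mono) auto
  finally show ?thesis unfolding L_def by (simp add: mult.assoc)
qed

section \<open>Embedding in the graph of light pairs\<close>

text \<open>A vertex outside this union is adjacent to no candidate middle vertex of any of the
  pairs. Each light pair has fewer than \<open>h\<close> candidates, each with at most
  \<open>\<Delta>\<close> neighbours.\<close>

lemma card_conflicts_le:
  fixes N :: "'b \<Rightarrow> 'a set"
  assumes "finite A" "finite B" and NA: "\<And>b. b \<in> B \<Longrightarrow> N b \<subseteq> A"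
    and deg: "\<And>b. b \<in> B \<Longrightarrow> card (N b) \<le> \<Delta>"
    and "finite I" and lt: "\<And>i. i \<in> I \<Longrightarrow> light B N h (u i) (v i)"
  shows "card (\<Union>i\<in>I. \<Union>b\<in>common B N (u i) (v i). N b) \<le> card I * (h * \<Delta>)"
proof -
  have "card (\<Union>b\<in>common B N (u i) (v i). N b) \<le> h * \<Delta>" if "i \<in> I" for i
  proof -
    have "card (\<Union>b\<in>common B N (u i) (v i). N b) \<le> (\<Sum>b\<in>common B N (u i) (v i). card (N b))"
      by (intro card_UN_le finite_common assms)
    also have "\<dots> \<le> (\<Sum>b\<in>common B N (u i) (v i). \<Delta>)"
      by (intro sum_mono deg) (auto simp: common_def)
    also have "\<dots> \<le> h * \<Delta>" using lt[OF that] by (simp add: light_def)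
    finally show ?thesis .
  qed
  then have "(\<Sum>i\<in>I. card (\<Union>b\<in>common B N (u i) (v i). N b)) \<le> card I * (h * \<Delta>)"
    using sum_bounded_above[of I _ "h * \<Delta>"] by simp
  with card_UN_le[OF assms(5)] show ?thesis by (rule order_trans)
qed

text \<open>At least \<open>\<delta> = \<Lambda> / (2 * n)\<close> vertices have light degree at
  least \<open>\<delta>\<close>. Each of \<open>s\<close> averaging steps keeps a proportion
  \<open>q = \<Lambda> / (4 * n\<^sup>2)\<close> of them, and by \<open>big\<close> more remain than
  the at most \<open>t * s * h * \<Delta>\<close> vertices blocked while the \<open>x k\<close> are
  chosen.\<close>

lemma linked_grid_if_many_light_pairs:
  fixes N :: "'b \<Rightarrow> 'a set" and \<Lambda> :: real
  assumes fA: "finite A" and fB: "finite B" and NA: "\<And>b. b \<in> B \<Longrightarrow> N b \<subseteq> A"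
    and deg: "\<And>b. b \<in> B \<Longrightarrow> card (N b) \<le> \<Delta>"
    and n: "card A \<le> n" and s: "1 \<le> s" and t: "2 \<le> t"
    and \<Lambda>: "\<Lambda> = real (card {(u, v) \<in> A \<times> A. light B N h u v})"
    and big: "real (t * s * h * \<Delta>) < (\<Lambda> / (4 * real n ^ 2)) ^ s * (\<Lambda> / (2 * real n))"
  shows "linked_grid B N s t"
proof -
  define q where "q = \<Lambda> / (4 * real n ^ 2)"
  define \<delta> where "\<delta> = \<Lambda> / (2 * real n)"
  define nb where "nb = (\<lambda>x. {v \<in> A. light B N h v x})"
  define X0 where "X0 = {x \<in> A. \<delta> \<le> real (card (nb x))}"
  have big': "real (t * s * h * \<Delta>) < q ^ s * \<delta>" using big by (simp add: q_def \<delta>_def)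
  have "\<Lambda> \<ge> 0" by (simp add: \<Lambda>)
  have "0 \<le> real (t * s * h * \<Delta>)" by simp
  \<comment> \<open>Since division by zero gives 0, a nonzero \<open>\<delta>\<close> forces
    \<open>n\<close> and \<open>\<Lambda>\<close> to be nonzero.\<close>
  with big' have "\<delta> \<noteq> 0" by (metis less_irrefl mult_zero_right order.strict_trans1)
  then have npos: "n > 0" and "\<Lambda> \<noteq> 0" unfolding \<delta>_def by auto
  then have Lpos: "\<Lambda> > 0" using \<open>\<Lambda> \<ge> 0\<close> by simp
  with npos have qpos: "q > 0" and dpos: "\<delta> > 0" by (simp_all add: q_def \<delta>_def)
  have fN: "finite (N b)" if "b \<in> B" for b using NA[OF that] fA finite_subset by blast
  have fX0: "finite X0" using fA by (simp add: X0_def)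
  have fnb: "finite (nb x)" for x using fA by (simp add: nb_def)
  \<comment> \<open>There are at most \<open>n\<^sup>2\<close> pairs, so \<open>q \<le> 1\<close>
    and \<open>big\<close> bounds \<open>\<delta>\<close> itself from below. As
    \<open>2 \<le> t\<close>, the conflicts at a single \<open>x\<close> then use up at most half of
    \<open>\<delta>\<close>.\<close>
  have "card {(u, v) \<in> A \<times> A. light B N h u v} \<le> card (A \<times> A)"
    using fA by (intro card_mono) auto
  also have "\<dots> \<le> n ^ 2" using n by (simp add: card_cartesian_product power2_eq_square mult_mono)
  finally have "real (card {(u, v) \<in> A \<times> A. light B N h u v}) \<le> real (n ^ 2)" by (rule of_nat_mono)
  then have "\<Lambda> \<le> real n ^ 2" by (simp add: \<Lambda>)
  also have "\<dots> \<le> 4 * real n ^ 2" by simp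
  finally have "q \<le> 1" using npos by (simp add: q_def)
  then have "q ^ s \<le> 1" using qpos by (intro power_le_one) auto
  then have "q ^ s * \<delta> \<le> \<delta>" using dpos by simp
  then have "real (t * (s * h * \<Delta>)) < \<delta>" using big' by (simp add: mult.assoc)
  moreover have "2 * (s * h * \<Delta>) \<le> t * (s * h * \<Delta>)" using t by (rule mult_right_mono) simp
  ultimately have half: "2 * real (s * h * \<Delta>) \<le> \<delta>" by linarith

  \<comment> \<open>Vertices outside \<open>X0\<close> contribute less than \<open>\<delta>\<close>
    each, hence at most \<open>\<Lambda> / 2\<close> together, and members of \<open>X0\<close> at
    most \<open>n\<close> each.\<close>
  have cX0: "\<delta> \<le> real (card X0)"
  proof -
    have "{(u, v) \<in> A \<times> A. light B N h u v} = (SIGMA u:A. nb u)"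
      by (auto simp: nb_def light_commute)
    then have "\<Lambda> = (\<Sum>u\<in>A. real (card (nb u)))"
      using fA fnb by (simp add: \<Lambda> card_SigmaI)
    also have "\<dots> \<le> (\<Sum>u\<in>A. (if u \<in> X0 then real n else 0) + \<delta>)"
    proof (rule sum_mono)
      fix u assume "u \<in> A"
      moreover have "card (nb u) \<le> n"
        using n card_mono[OF fA, of "nb u"] by (auto simp: nb_def)
      ultimately show "real (card (nb u)) \<le> (if u \<in> X0 then real n else 0) + \<delta>"
        using dpos by (auto simp: X0_def)
    qed
    also have "\<dots> = real (card X0) * real n + real (card A) * \<delta>"
    proof -
      have "{u \<in> A. u \<in> X0} = X0" by (auto simp: X0_def)
      then show ?thesis using fA by (simp add: sum.distrib flip: sum.inter_filter)
    qed
    also have "\<dots> \<le> real (card X0) * real n + \<Lambda> / 2"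
    proof -
      have "real (card A) * \<delta> \<le> real n * \<delta>" using n dpos by simp
      then show ?thesis using npos by (simp add: \<delta>_def)
    qed
    finally show ?thesis using npos by (simp add: \<delta>_def field_simps)
  qed

  \<comment> \<open>The invariant makes the whole candidate sets at a fixed \<open>x\<close>
    disjoint, so no middle vertex has to be fixed before all branch vertices are known.\<close>
  have "\<exists>y X. X \<subseteq> X0 \<and> q ^ i * \<delta> \<le> real (card X) \<and>
      (\<forall>x\<in>X. \<forall>j<i. light B N h (y j) x \<and>
        (\<forall>j'<j. common B N (y j') x \<inter> common B N (y j) x = {}))" if "i \<le> s" for i
    using that
  proof (induction i)
    case 0
    then show ?case using cX0 by (intro exI[of _ undefined] exI[of _ X0]) auto
  next
    case (Suc i)
    then obtain y X where X: "X \<subseteq> X0" "q ^ i * \<delta> \<le> real (card X)"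
      and yl: "\<And>x j. x \<in> X \<Longrightarrow> j < i \<Longrightarrow> light B N h (y j) x"
      and yd: "\<And>x j j'. x \<in> X \<Longrightarrow> j < i \<Longrightarrow> j' < j \<Longrightarrow> common B N (y j') x \<inter> common B N (y j) x = {}"
      by (metis Suc_leD)
    have fX: "finite X" using X(1) fX0 finite_subset by blast
    \<comment> \<open>A vertex outside \<open>W x\<close> is adjacent to no candidate between
      \<open>x\<close> and an earlier \<open>y j\<close>; taking it as the next \<open>y\<close>
      keeps the candidate sets at \<open>x\<close> disjoint.\<close>
    define W where "W = (\<lambda>x. \<Union>j\<in>{..<i}. \<Union>b\<in>common B N (y j) x. N b)"
    define Y where "Y = (\<lambda>v. {x \<in> X. v \<in> nb x - W x})"
    have good: "\<delta> / 2 \<le> real (card (nb x - W x))" if x: "x \<in> X" for x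
    proof -
      have "card (W x) \<le> card {..<i} * (h * \<Delta>)"
        unfolding W_def by (rule card_conflicts_le[OF fA fB NA deg]) (auto intro: yl x)
      also have "\<dots> \<le> s * (h * \<Delta>)" using Suc.prems by (intro mult_right_mono) auto
      finally have "card (W x) \<le> s * h * \<Delta>" by (simp add: mult.assoc)
      then have "real (card (W x)) \<le> real (s * h * \<Delta>)" by (rule of_nat_mono)
      moreover have "card (nb x) \<le> card (nb x - W x) + card (W x)"
      proof -
        have "finite (W x)" unfolding W_def
          by (intro finite_UN_I finite_common fB) (auto simp: common_def intro: fN)
        then show ?thesis
          using card_mono[of "(nb x - W x) \<union> W x" "nb x"] card_Un_le[of "nb x - W x" "W x"] fnb
          by fastforce
      qed
      moreover have "\<delta> \<le> real (card (nb x))" using x X(1) by (auto simp: X0_def)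
      ultimately show ?thesis using half by linarith
    qed
    \<comment> \<open>Averaging: every \<open>x\<close> in \<open>X\<close> still has
      \<open>\<delta> / 2\<close> admissible light neighbours, so some \<open>v\<close> in
      \<open>A\<close> is admissible for a proportion of at least
      \<open>\<delta> / (2 * n) = q\<close> of \<open>X\<close>.\<close>
    have "\<exists>v\<in>A. q ^ Suc i * \<delta> \<le> real (card (Y v))"
    proof (rule ccontr)
      assume "\<not> ?thesis"
      then have less: "\<And>v. v \<in> A \<Longrightarrow> real (card (Y v)) < q ^ Suc i * \<delta>" by force
      have "q ^ i * \<delta> > 0" using qpos dpos by simp
      then have "card X > 0" using X(2) by linarith
      then have Ane: "A \<noteq> {}" using X(1) by (auto simp: X0_def)
      have "real (card X) * (\<delta> / 2) \<le> (\<Sum>x\<in>X. real (card (nb x - W x)))"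
        using sum_mono[of X "\<lambda>_. \<delta> / 2", OF good] by simp
      also have "\<dots> = real (\<Sum>x\<in>X. card {v \<in> A. v \<in> nb x - W x})"
        by (simp add: nb_def, intro sum.cong refl arg_cong[of _ _ card] arg_cong[of _ _ real]) auto
      also have "\<dots> = real (\<Sum>v\<in>A. card (Y v))"
        using sum.swap_restrict[OF fX fA, of "\<lambda>_ _. 1::nat" "\<lambda>x v. v \<in> nb x - W x"]
        by (simp add: Y_def)
      also have "\<dots> < (\<Sum>v\<in>A. q ^ Suc i * \<delta>)"
        unfolding of_nat_sum using fA Ane less by (rule sum_strict_mono)
      also have "\<dots> = real (card A) * (q ^ Suc i * \<delta>)" by simp
      also have "\<dots> \<le> real n * (q ^ Suc i * \<delta>)" using n qpos dpos by (intro mult_right_mono) auto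
      also have "\<dots> = (q ^ i * \<delta>) * (\<delta> / 2)"
        using npos by (simp add: q_def \<delta>_def field_simps power2_eq_square)
      also have "\<dots> \<le> real (card X) * (\<delta> / 2)" using X(2) dpos by (intro mult_right_mono) auto
      finally show False by simp
    qed
    then obtain v where v: "v \<in> A" "q ^ Suc i * \<delta> \<le> real (card (Y v))" by blast
    have YX: "Y v \<subseteq> X" by (auto simp: Y_def)
    have lv: "light B N h v x" if "x \<in> Y v" for x using that by (auto simp: Y_def nb_def)
    have dv: "common B N (y j) x \<inter> common B N v x = {}" if "x \<in> Y v" "j < i" for x j
      using that by (auto simp: Y_def W_def common_def)
    show ?case
    proof (intro exI[of _ "y(i := v)"] exI[of _ "Y v"] conjI ballI allI impI)
      show "Y v \<subseteq> X0" using YX X(1) by blast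
      show "q ^ Suc i * \<delta> \<le> real (card (Y v))" by fact
      fix x j assume x: "x \<in> Y v" and j: "j < Suc i"
      show "light B N h ((y(i := v)) j) x"
        using x j YX yl lv by (auto simp: less_Suc_eq)
      fix j' assume "j' < j"
      then show "common B N ((y(i := v)) j') x \<inter> common B N ((y(i := v)) j) x = {}"
        using x j dv[OF x, of j'] yd[of x j j'] YX by (cases "j = i") auto
    qed
  qed
  from this[OF order_refl] obtain y X where X: "X \<subseteq> X0" "q ^ s * \<delta> \<le> real (card X)"
    and yX: "\<forall>x\<in>X. \<forall>j<s. light B N h (y j) x \<and>
        (\<forall>j'<j. common B N (y j') x \<inter> common B N (y j) x = {})"
    by (elim exE conjE)
  have yl: "light B N h (y j) x" if "x \<in> X" "j < s" for x j
    using yX that by blast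
  have yd: "common B N (y j') x \<inter> common B N (y j) x = {}" if "x \<in> X" "j < s" "j' < j" for x j j'
    using yX that by blast
  have cX: "t * s * h * \<Delta> < card X" using X(2) big' by linarith

  \<comment> \<open>Later vertices avoid the neighbourhoods of all candidates at earlier ones, so
    candidate sets at different \<open>x k\<close> are disjoint as well.\<close>
  have "\<exists>x. (\<forall>k<r. x k \<in> X) \<and> (\<forall>k<r. \<forall>k'<k. \<forall>j<s. \<forall>b\<in>common B N (y j) (x k'). x k \<notin> N b)"
    if "r \<le> t" for r
    using that
  proof (induction r)
    case 0
    then show ?case by simp
  next
    case (Suc r)
    then obtain x where xX: "\<And>k. k < r \<Longrightarrow> x k \<in> X"
      and xd: "\<And>k k' j b. k < r \<Longrightarrow> k' < k \<Longrightarrow> j < s \<Longrightarrow> b \<in> common B N (y j) (x k') \<Longrightarrow> x k \<notin> N b"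
      by (metis Suc_leD)
    define W where "W = (\<Union>p\<in>{..<s} \<times> {..<r}. \<Union>b\<in>common B N (y (fst p)) (x (snd p)). N b)"
    have "card W \<le> card ({..<s} \<times> {..<r}) * (h * \<Delta>)"
      unfolding W_def by (rule card_conflicts_le[OF fA fB NA deg]) (auto intro!: yl xX)
    also have "\<dots> = r * (s * h * \<Delta>)" by simp
    also have "\<dots> \<le> t * (s * h * \<Delta>)" using Suc.prems by (intro mult_right_mono) auto
    finally have "card W < card X" using cX by (simp add: mult.assoc)
    moreover have "finite W" unfolding W_def
      by (intro finite_UN_I finite_common fB) (auto simp: common_def intro: fN)
    ultimately have "\<not> X \<subseteq> W" using card_mono not_less by blast
    then obtain w where w: "w \<in> X" "w \<notin> W" by blast
    have "w \<notin> N b" if "k' < r" "j < s" "b \<in> common B N (y j) (x k')" for k' j b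
      using w(2) that unfolding W_def by fastforce
    then show ?case using w(1) xX xd
      by (intro exI[of _ "x(r := w)"]) (auto simp: less_Suc_eq)
  qed
  from this[OF order_refl] obtain x where xX': "\<forall>k<t. x k \<in> X"
    and xd': "\<forall>k<t. \<forall>k'<k. \<forall>j<s. \<forall>b\<in>common B N (y j) (x k'). x k \<notin> N b"
    by (elim exE conjE)
  have xX: "x k \<in> X" if "k < t" for k using xX' that by blast
  have xd: "x k \<notin> N b" if "k < t" "k' < k" "j < s" "b \<in> common B N (y j) (x k')" for k k' j b
    using xd' that by blast
  \<comment> \<open>Any choice will do, because the candidate sets of different index pairs are
    disjoint.\<close>
  define m where "m = (\<lambda>(j, k). SOME b. b \<in> common B N (y j) (x k))"
  have lt: "light B N h (y j) (x k)" if "j < s" "k < t" for j k using yl xX that by blast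
  have m: "m (j, k) \<in> common B N (y j) (x k)" if "j < s" "k < t" for j k
    using lt[OF that] unfolding m_def by (auto simp: light_def intro: someI)
  have mN: "x k \<in> N (m (j, k))" if "j < s" "k < t" for j k
    using m[OF that] by (simp add: common_def)
  have sep: "m (j, k) \<noteq> m (j', k')" if "j < s" "j' < s" "k' < k" "k < t" for j j' k k'
    using xd[OF that(4,3,2) m] mN[OF that(1,4)] that by (metis less_trans)
  have sep': "m (j, k) \<noteq> m (j', k)" if "j < s" "j' < j" "k < t" for j j' k
    using yd[OF xX[OF that(3)] that(1,2)] m[OF that(1,3)] m[OF less_trans[OF that(2,1)] that(3)]
    by (metis disjoint_iff)
  \<comment> \<open>If the two agreed, \<open>x k\<close> would be adjacent to
    \<open>m (0, k')\<close>, a candidate at \<open>x k'\<close>; the index 0 is available by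
    \<open>1 \<le> s\<close>.\<close>
  have "x k \<noteq> x k'" if "k < t" "k' < k" for k k'
    using xd[OF that _ m] mN[OF _ less_trans[OF that(2,1)]] s less_trans[OF that(2,1)]
    by (metis less_le_trans zero_less_one)
  then have injx: "inj_on x {..<t}"
    by (intro inj_onI) (metis lessThan_iff linorder_neqE_nat)
  have "0 < t" using t by simp
  \<comment> \<open>Equal values would have the same nonempty set of candidates at
    \<open>x 0\<close>, against disjointness.\<close>
  have "y j \<noteq> y j'" if "j < s" "j' < j" for j j'
    using yd[OF xX[OF \<open>0 < t\<close>] that] m[OF that(1) \<open>0 < t\<close>] by (metis disjoint_iff)
  then have injy: "inj_on y {..<s}"
    by (intro inj_onI) (metis lessThan_iff linorder_neqE_nat)
  have injm: "inj_on m ({..<s} \<times> {..<t})"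
  proof (rule inj_onI, clarsimp)
    fix j k j' k' assume *: "j < s" "k < t" "j' < s" "k' < t" "m (j, k) = m (j', k')"
    then have "k = k'" using sep by (metis linorder_neqE_nat)
    then show "j = j' \<and> k = k'" using * sep' by (metis linorder_neqE_nat)
  qed
  have "y ` {..<s} \<inter> x ` {..<t} = {}" using lt by (force simp: light_def)
  show ?thesis unfolding linked_grid_def
  proof (rule exI[of _ y], rule exI[of _ x], rule exI[of _ m], intro conjI allI impI)
    show "y ` {..<s} \<inter> x ` {..<t} = {}" "inj_on y {..<s}" "inj_on x {..<t}" "inj_on m ({..<s} \<times> {..<t})" by fact+
    show "m (j, k) \<in> common B N (y j) (x k)" if "j < s" "k < t" for j k using m that .
  qed
qed

text \<open>\<open>big\<close> is the condition of \<open>linked_grid_if_many_light_pairs\<close>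
  for \<open>h = s * t\<close> and \<open>\<Delta> = 2 * D\<close>, with the lower bound
  \<open>c * E * D\<close> from \<open>card_light_pairs_ge\<close> in place of
  \<open>\<Lambda>\<close>, cleared of denominators and of one factor \<open>D\<close>.\<close>

lemma linked_grid_if_near_regular:
  fixes N :: "'b \<Rightarrow> 'a set" and c E :: real
  assumes fA: "finite A" and fB: "finite B" and NA: "\<And>b. b \<in> B \<Longrightarrow> N b \<subseteq> A"
    and D: "\<And>b. b \<in> B \<Longrightarrow> D \<le> card (N b) \<and> card (N b) \<le> 2 * D" "2 * 4 ^ (s + t) \<le> D"
    and n: "card A \<le> n" "0 < n" and s: "1 \<le> s" and t: "2 \<le> t"
    and E: "E = real (card B * D)" and c: "c = 1 / real (2 * 4 ^ (s + t) * (s * t))"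
    and big: "4 ^ (s + 1) * real n ^ (2 * s + 1) * real (t * s * (s * t)) < real D ^ s * (c * E) ^ (s + 1)"
  shows "linked_grid B N s t"
proof (rule ccontr)
  assume no: "\<not> linked_grid B N s t"
  define \<Lambda> where "\<Lambda> = real (card {(u, v) \<in> A \<times> A. light B N (s * t) u v})"
  have st: "s * t > 0" using s t by simp
  have Dpos: "D > 0" using D(2) by (rule less_le_trans[rotated]) simp
  have "card B * D\<^sup>2 \<le> 2 * 4 ^ (s + t) * (s * t) * card {(u, v) \<in> A \<times> A. light B N (s * t) u v}"
    using D no by (intro card_light_pairs_ge fA fB NA) auto
  then have "real (card B * D\<^sup>2) \<le> real (2 * 4 ^ (s + t) * (s * t)) * \<Lambda>"
    unfolding \<Lambda>_def of_nat_mult[symmetric] by (rule of_nat_mono)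
  moreover have "real (2 * 4 ^ (s + t) * (s * t)) > 0" using st by simp
  ultimately have \<Lambda>_ge: "c * E * real D \<le> \<Lambda>"
    unfolding c E by (simp add: divide_simps power2_eq_square mult_ac)
  have cE: "0 \<le> c * E" by (simp add: c E)
  have "real (t * s * (s * t) * (2 * D)) * (4 ^ s * 2 * real n ^ (2 * s + 1))
      = 4 ^ (s + 1) * real n ^ (2 * s + 1) * real (t * s * (s * t)) * real D"
    by simp
  also have "\<dots> < real D ^ s * (c * E) ^ (s + 1) * real D"
    using big Dpos by simp
  also have "\<dots> = (c * E * real D) ^ (s + 1)" by (simp add: power_mult_distrib)
  also have "\<dots> \<le> \<Lambda> ^ (s + 1)" using cE by (intro power_mono \<Lambda>_ge) simp
  finally have "real (t * s * (s * t) * (2 * D)) < \<Lambda> ^ (s + 1) / (4 ^ s * 2 * real n ^ (2 * s + 1))"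
    using n(2) by (subst pos_less_divide_eq) auto
  also have "\<dots> = (\<Lambda> / (4 * real n ^ 2)) ^ s * (\<Lambda> / (2 * real n))"
  proof -
    have "(real n ^ 2) ^ s = real n ^ (2 * s)" by (rule power_mult[symmetric])
    then show ?thesis by (simp add: power_mult_distrib power_divide mult_ac)
  qed
  finally have "linked_grid B N s t"
    using D by (intro linked_grid_if_many_light_pairs[OF fA fB NA _ n(1) s t \<Lambda>_def]) auto
  with no show False ..
qed

section \<open>Reduction to a near-regular bipartite graph\<close>

text \<open>Vertices of degree below \<open>e / (2 * n)\<close> carry at most half of the sum and
  are dropped first, which gives the lower bound on \<open>D\<close>. By pigeonhole, one of the
  \<open>K\<close> dyadic classes of the rest carries a share of at least
  \<open>1 / K\<close>.\<close>

lemma dyadic_degree_class: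
  fixes N :: "'b \<Rightarrow> 'a set"
  assumes fB: "finite B" and n: "card B \<le> n" and K: "\<And>b. b \<in> B \<Longrightarrow> card (N b) < 2 ^ K"
    and e: "e = (\<Sum>b\<in>B. card (N b))"
  shows "\<exists>D B'. B' \<subseteq> B \<and> (\<forall>b\<in>B'. D \<le> card (N b) \<and> card (N b) \<le> 2 * D) \<and>
    e \<le> 4 * K * (card B' * D) \<and> e \<le> 4 * n * D"
proof (cases "e = 0")
  case True
  then show ?thesis by (intro exI[of _ 0] exI[of _ "{}"]) simp
next
  case False
  define d where "d = (\<lambda>b. card (N b))"
  have "B \<noteq> {}" using False e by auto
  then have npos: "n > 0" using n fB by (metis card_gt_0_iff less_le_trans)
  define C where "C = {b \<in> B. e \<le> 2 * n * d b}"
  have fC: "finite C" using fB by (simp add: C_def)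
  have "2 * n * e = (\<Sum>b\<in>B. 2 * n * d b)" by (simp add: e d_def sum_distrib_left)
  also have "\<dots> \<le> (\<Sum>b\<in>B. e + (if b \<in> C then 2 * n * d b else 0))"
    by (intro sum_mono) (auto simp: C_def)
  also have "\<dots> = card B * e + (\<Sum>b\<in>C. 2 * n * d b)"
  proof -
    have "{b \<in> B. b \<in> C} = C" by (auto simp: C_def)
    then show ?thesis using fB by (simp add: sum.distrib flip: sum.inter_filter)
  qed
  also have "\<dots> \<le> n * e + 2 * n * (\<Sum>b\<in>C. d b)"
    using n by (simp add: sum_distrib_left)
  finally have "n * e \<le> n * (2 * (\<Sum>b\<in>C. d b))" by (simp add: algebra_simps)
  then have eC: "e \<le> 2 * (\<Sum>b\<in>C. d b)" using npos by simp
  have "\<forall>b\<in>C. \<exists>k. 2 ^ k \<le> d b \<and> d b < 2 ^ (k + 1)"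
  proof
    fix b assume "b \<in> C"
    then have "1 \<le> d b" using False by (cases "d b") (auto simp: C_def)
    then show "\<exists>k. 2 ^ k \<le> d b \<and> d b < 2 ^ (k + 1)" by (intro ex_power_ivl1) auto
  qed
  then obtain \<kappa> where \<kappa>: "\<And>b. b \<in> C \<Longrightarrow> 2 ^ \<kappa> b \<le> d b" "\<And>b. b \<in> C \<Longrightarrow> d b < 2 ^ (\<kappa> b + 1)"
    by metis
  have \<kappa>K: "\<kappa> b < K" if "b \<in> C" for b
  proof -
    have "d b < 2 ^ K" using K that by (auto simp: C_def d_def)
    with \<kappa>(1)[OF that] have "(2::nat) ^ \<kappa> b < 2 ^ K" by (rule le_less_trans)
    then show ?thesis by simp
  qed
  define S where "S = (\<lambda>k. \<Sum>b | b \<in> C \<and> \<kappa> b = k. d b)"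
  have group: "(\<Sum>k<K. S k) = (\<Sum>b\<in>C. d b)"
    unfolding S_def using fC \<kappa>K by (intro sum.group) auto
  have "\<exists>k. (\<Sum>b\<in>C. d b) \<le> K * S k"
  proof (rule ccontr)
    assume "\<not> ?thesis"
    then have less: "\<And>k. K * S k < (\<Sum>b\<in>C. d b)" by (simp add: not_le)
    have "K > 0" using group eC False by (intro gr0I) auto
    then have "(\<Sum>k<K. K * S k) < (\<Sum>k<K. \<Sum>b\<in>C. d b)"
      by (intro sum_strict_mono less) auto
    then show False by (simp add: group flip: sum_distrib_left)
  qed
  then obtain k where k: "(\<Sum>b\<in>C. d b) \<le> K * S k" by blast
  define B' where "B' = {b \<in> C. \<kappa> b = k}"
  have B': "2 ^ k \<le> d b" "d b \<le> 2 * 2 ^ k" "e \<le> 2 * n * d b" if "b \<in> B'" for b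
    using \<kappa>[of b] that by (auto simp: B'_def C_def)
  have "S k \<le> (\<Sum>b\<in>B'. 2 * 2 ^ k)"
    unfolding S_def B'_def[symmetric] by (intro sum_mono B'(2))
  then have "K * S k \<le> K * (card B' * (2 * 2 ^ k))" by (intro mult_left_mono) auto
  then have "e \<le> 2 * (K * (card B' * (2 * 2 ^ k)))" using eC k by linarith
  then have e1: "e \<le> 4 * K * (card B' * 2 ^ k)" by (simp add: mult_ac)
  then have "B' \<noteq> {}" using False by auto
  then obtain b where b: "b \<in> B'" by blast
  have "e \<le> 2 * n * d b" by (rule B'(3)[OF b])
  also have "\<dots> \<le> 2 * n * (2 * 2 ^ k)" by (intro mult_left_mono B'(2) b) simp
  also have "\<dots> = 4 * n * 2 ^ k" by simp
  finally have "e \<le> 4 * n * 2 ^ k" .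
  moreover have "B' \<subseteq> B" by (auto simp: B'_def C_def)
  ultimately show ?thesis using e1 B'(1,2)
    by (intro exI[of _ "2 ^ k"] exI[of _ B']) (auto simp: d_def)
qed

text \<open>Every edge at the new vertex \<open>v\<close> is cut for one of the two sides on which
  \<open>v\<close> can be placed, so the better side cuts at least half of them; edges avoiding
  \<open>v\<close> are unaffected.\<close>

lemma large_cut:
  fixes V :: "'a set"
  assumes "finite V" "finite F" "\<And>e. e \<in> F \<Longrightarrow> e \<subseteq> V \<and> card e = 2"
  shows "\<exists>A\<subseteq>V. card F \<le> 2 * card {e \<in> F. card (e \<inter> A) = 1}"
  using assms
proof (induction V arbitrary: F rule: finite_induct)
  case empty
  then have "F = {}" by fastforce
  then show ?case by simp
next
  case (insert v V)
  define F0 where "F0 = {e \<in> F. v \<notin> e}"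
  define F1 where "F1 = {e \<in> F. v \<in> e}"
  have F: "F = F0 \<union> F1" "F0 \<inter> F1 = {}" and fin: "finite F0" "finite F1"
    using insert.prems(1) by (auto simp: F0_def F1_def)
  have "\<exists>A\<subseteq>V. card F0 \<le> 2 * card {e \<in> F0. card (e \<inter> A) = 1}"
    using insert.prems(2) fin by (intro insert.IH) (auto simp: F0_def)
  then obtain A where A: "A \<subseteq> V" "card F0 \<le> 2 * card {e \<in> F0. card (e \<inter> A) = 1}" by blast
  have vA: "v \<notin> A" using A(1) insert.hyps by blast
  define cut where "cut = (\<lambda>(F :: 'a set set) A'. {e \<in> F. card (e \<inter> A') = 1})"
  have split: "card (cut F A') = card (cut F0 A') + card (cut F1 A')" for A'
  proof -
    have "cut F A' = cut F0 A' \<union> cut F1 A'" using F(1) by (auto simp: cut_def)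
    then show ?thesis using F(2) fin by (auto simp: cut_def intro: card_Un_disjoint)
  qed
  have F0: "cut F0 (insert v A) = cut F0 A" by (auto simp: cut_def F0_def)
  have "F1 \<subseteq> cut F1 A \<union> cut F1 (insert v A)"
  proof
    fix e assume e: "e \<in> F1"
    then have "card e = 2" "v \<in> e" using insert.prems(2) by (auto simp: F1_def)
    then obtain u where u: "e = {v, u}" "u \<noteq> v"
      by (auto simp: card_2_iff doubleton_eq_iff)
    show "e \<in> cut F1 A \<union> cut F1 (insert v A)"
      using u vA e by (cases "u \<in> A") (auto simp: cut_def)
  qed
  then have "card F1 \<le> card (cut F1 A \<union> cut F1 (insert v A))"
    using fin by (intro card_mono) (auto simp: cut_def)
  then have F1: "card F1 \<le> card (cut F1 A) + card (cut F1 (insert v A))"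
    using card_Un_le order_trans by blast
  have "card F = card F0 + card F1" using F fin by (simp add: card_Un_disjoint)
  then have "card F \<le> 2 * card (cut F A) \<or> card F \<le> 2 * card (cut F (insert v A))"
    using A(2) F1 unfolding split F0 by (auto simp: cut_def)
  then show ?case using A(1) unfolding cut_def by blast
qed

section \<open>From grids to copies of the subdivision\<close>

text \<open>Branch vertices go to \<open>A\<close> and middle vertices to \<open>B\<close>, so
  disjointness of \<open>A\<close> and \<open>B\<close> excludes coincidences between the two kinds,
  and the grid excludes all others.\<close>

lemma contains_copy_if_linked_grid:
  fixes G :: "'a graph"
  assumes B: "B \<subseteq> verts G" "A \<subseteq> verts G" "A \<inter> B = {}"
    and N: "\<And>b. b \<in> B \<Longrightarrow> N b \<subseteq> {a \<in> A. {a, b} \<in> edges G}"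
    and grid: "linked_grid B N s t" and st: "1 \<le> s" "1 \<le> t"
  shows "contains_copy G (subdivision (complete_bipartite s t))"
proof -
  obtain y x m where inj: "inj_on y {..<s}" "inj_on x {..<t}" "inj_on m ({..<s} \<times> {..<t})"
    and yx: "y ` {..<s} \<inter> x ` {..<t} = {}"
    and m: "\<And>j k. j < s \<Longrightarrow> k < t \<Longrightarrow> m (j, k) \<in> common B N (y j) (x k)"
    using grid unfolding linked_grid_def by auto
  \<comment> \<open>Middle vertices of \<open>subdivision\<close> are labelled by edges, as
    two-element sets, whereas \<open>m\<close> takes index pairs; \<open>idx\<close>
    translates.\<close>
  define idx :: "(nat + nat) set \<Rightarrow> nat \<times> nat"
    where "idx = (\<lambda>e. (THE j. Inl j \<in> e, THE k. Inr k \<in> e))"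
  have idx: "idx {Inl j, Inr k} = (j, k)" for j k
    by (auto simp: idx_def)
  define f where "f = case_sum (case_sum y x) (m \<circ> idx)"
  have mB: "m (j, k) \<in> B" "{y j, m (j, k)} \<in> edges G" "{x k, m (j, k)} \<in> edges G"
    "y j \<in> A" "x k \<in> A" if "j < s" "k < t" for j k
    using m[OF that] N by (auto simp: common_def)
  have yA: "y j \<in> A" if "j < s" for j using mB(4)[OF that, of 0] st by simp
  have xA: "x k \<in> A" if "k < t" for k using mB(5)[OF _ that, of 0] st by simp
  have verts: "verts (subdivision (complete_bipartite s t)) =
      Inl ` (Inl ` {..<s} \<union> Inr ` {..<t}) \<union> (\<lambda>(j, k). Inr {Inl j, Inr k}) ` ({..<s} \<times> {..<t})"
    by (auto simp: subdivision_def complete_bipartite_def)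
  have "inj_on f (verts (subdivision (complete_bipartite s t)))"
  proof (rule inj_onI)
    fix p q assume pq: "p \<in> verts (subdivision (complete_bipartite s t))"
      "q \<in> verts (subdivision (complete_bipartite s t))" "f p = f q"
    have ym: "y j \<noteq> m (j', k')" "m (j', k') \<noteq> y j" if "j < s" "j' < s" "k' < t" for j j' k'
      using yA[OF that(1)] mB(1)[OF that(2,3)] B(3) by auto
    have xm: "x k \<noteq> m (j', k')" "m (j', k') \<noteq> x k" if "k < t" "j' < s" "k' < t" for k j' k'
      using xA[OF that(1)] mB(1)[OF that(2,3)] B(3) by auto
    have xy: "y j \<noteq> x k" "x k \<noteq> y j" if "j < s" "k < t" for j k using yx that by auto
    have cases: "(\<exists>j<s. w = Inl (Inl j)) \<or> (\<exists>k<t. w = Inl (Inr k)) \<or>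
        (\<exists>j<s. \<exists>k<t. w = Inr {Inl j, Inr k})"
      if "w \<in> verts (subdivision (complete_bipartite s t))" for w
      using that unfolding verts by auto
    show "p = q"
      using cases[OF pq(1)] cases[OF pq(2)] pq(3) ym xm xy
        inj_onD[OF inj(1)] inj_onD[OF inj(2)] inj_onD[OF inj(3)]
      by (elim disjE exE conjE) (fastforce simp: f_def idx)+
  qed
  moreover have "f ` verts (subdivision (complete_bipartite s t)) \<subseteq> verts G"
    using yA xA mB(1) B unfolding verts by (auto simp: f_def idx)
  moreover have "f ` e \<in> edges G" if eH: "e \<in> edges (subdivision (complete_bipartite s t))" for e
  proof -
    obtain w e' where e': "e = {Inl w, Inr e'}" "e' \<in> edges (complete_bipartite s t)" "w \<in> e'"
      using eH by (auto simp: subdivision_def)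
    from e'(2) obtain j k where jk: "e' = {Inl j, Inr k}" "j < s" "k < t"
      by (auto simp: complete_bipartite_def)
    with e'(1,3) have "e = {Inl (Inl j), Inr {Inl j, Inr k}} \<or> e = {Inl (Inr k), Inr {Inl j, Inr k}}"
      by auto
    then show ?thesis using mB(2,3)[OF jk(2,3)] by (auto simp: f_def idx)
  qed
  ultimately show ?thesis unfolding contains_copy_def by blast
qed

text \<open>\<open>large_cut\<close> and \<open>dyadic_degree_class\<close> lead to a near-regular
  bipartite graph at the cost of factors 2 and 4, hence the 8. As there is no copy,
  \<open>linked_grid_if_near_regular\<close> must fail to apply, which is the final disjunction;
  \<open>E\<close> stands for \<open>card B' * D\<close>.\<close>

lemma edges_bound:
  fixes G :: "'a graph" and c :: real
  assumes G: "finite_simple_graph G" and no: "\<not> contains_copy G (subdivision (complete_bipartite s t))"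
    and n: "card (verts G) = n" "n < 2 ^ K" and s: "1 \<le> s" and t: "2 \<le> t"
    and c: "c = 1 / real (2 * 4 ^ (s + t) * (s * t))"
  obtains D E :: nat where "card (edges G) \<le> 8 * K * E" "card (edges G) \<le> 8 * n * D"
    "D < 2 * 4 ^ (s + t) \<or> real D ^ s * (c * real E) ^ (s + 1)
      \<le> 4 ^ (s + 1) * real n ^ (2 * s + 1) * real (t * s * (s * t))"
proof -
  have fV: "finite (verts G)" and ed: "\<And>e. e \<in> edges G \<Longrightarrow> e \<subseteq> verts G \<and> card e = 2"
    using G by (auto simp: finite_simple_graph_def)
  obtain A where A: "A \<subseteq> verts G"
    and cut: "card (edges G) \<le> 2 * card {e \<in> edges G. card (e \<inter> A) = 1}"
    using large_cut[OF fV finite_edges[OF G]] ed by blast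
  define B where "B = verts G - A"
  define N where "N = (\<lambda>b. {a \<in> A. {a, b} \<in> edges G})"
  have fA: "finite A" and fB: "finite B" using A fV finite_subset by (auto simp: B_def)
  have cA: "card A \<le> n" and cB: "card B \<le> n"
    using A fV n(1) by (auto simp: B_def intro: card_mono)
  have fN: "finite (N b)" and NA: "N b \<subseteq> A" for b using fA by (auto simp: N_def)
  have "card (N b) \<le> n" for b using card_mono[OF fA NA] cA by (rule le_trans)
  then have deg: "card (N b) < 2 ^ K" for b using n(2) by (rule le_less_trans)
  have "{e \<in> edges G. card (e \<inter> A) = 1} \<subseteq> (\<lambda>(b, a). {a, b}) ` (SIGMA b:B. N b)"
  proof
    fix e assume "e \<in> {e \<in> edges G. card (e \<inter> A) = 1}"
    then have e: "e \<in> edges G" "card (e \<inter> A) = 1" by auto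
    then obtain a where a: "e \<inter> A = {a}" by (auto simp: card_1_singleton_iff)
    then have "a \<in> e" "a \<in> A" by auto
    then obtain b where b: "e = {a, b}" "a \<noteq> b"
      using ed[OF e(1)] by (auto simp: card_2_iff doubleton_eq_iff)
    have "b \<in> B" using a b ed[OF e(1)] by (auto simp: B_def)
    then show "e \<in> (\<lambda>(b, a). {a, b}) ` (SIGMA b:B. N b)"
      using e(1) b \<open>a \<in> A\<close> by (auto simp: N_def)
  qed
  then have "card {e \<in> edges G. card (e \<inter> A) = 1} \<le> card ((\<lambda>(b, a). {a, b}) ` (SIGMA b:B. N b))"
    using fB fN by (intro card_mono) auto
  also have "\<dots> \<le> card (SIGMA b:B. N b)" using fB fN by (intro card_image_le) auto
  also have "\<dots> = (\<Sum>b\<in>B. card (N b))" using fB fN by (intro card_SigmaI) auto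
  finally have e: "card (edges G) \<le> 2 * (\<Sum>b\<in>B. card (N b))" using cut by linarith
  obtain D B' where B': "B' \<subseteq> B" "\<forall>b\<in>B'. D \<le> card (N b) \<and> card (N b) \<le> 2 * D"
    "(\<Sum>b\<in>B. card (N b)) \<le> 4 * K * (card B' * D)" "(\<Sum>b\<in>B. card (N b)) \<le> 4 * n * D"
    using dyadic_degree_class[where N = N, OF fB cB deg refl] by (elim exE conjE)
  have B'G: "B' \<subseteq> verts G" "A \<inter> B' = {}" using B'(1) by (auto simp: B_def)
  have "\<not> linked_grid B' N s t"
    using contains_copy_if_linked_grid[OF B'G(1) A B'G(2), of N s t] no s t by (auto simp: N_def)
  moreover have "linked_grid B' N s t" if "2 * 4 ^ (s + t) \<le> D" "0 < n"
    "4 ^ (s + 1) * real n ^ (2 * s + 1) * real (t * s * (s * t))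
      < real D ^ s * (c * real (card B' * D)) ^ (s + 1)"
  proof (rule linked_grid_if_near_regular[OF fA _ _ _ that(1) cA that(2) s t refl c that(3)])
    show "finite B'" using B'(1) fB finite_subset by blast
  qed (use B' NA in auto)
  ultimately have big: "D < 2 * 4 ^ (s + t) \<or> real D ^ s * (c * real (card B' * D)) ^ (s + 1)
      \<le> 4 ^ (s + 1) * real n ^ (2 * s + 1) * real (t * s * (s * t))" if "0 < n"
    using that by (meson not_le)
  \<comment> \<open>With no vertices, \<open>B'\<close> is empty and both sides of the inequality
    vanish.\<close>
  have "B' = {}" if "n = 0" using that n(1) fV B'G(1) by auto
  then have "D < 2 * 4 ^ (s + t) \<or> real D ^ s * (c * real (card B' * D)) ^ (s + 1)
      \<le> 4 ^ (s + 1) * real n ^ (2 * s + 1) * real (t * s * (s * t))"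
    using big by (cases "n = 0") (simp, blast)
  moreover have "card (edges G) \<le> 8 * K * (card B' * D)" "card (edges G) \<le> 8 * n * D"
    using e B'(3,4) by simp_all
  ultimately show thesis by (intro that)
qed

section \<open>Exponents and constants\<close>

text \<open>The value \<open>1 / (12 * t)\<close> comes from here: the exponents on the right add up
  to \<open>2 * s + 3 / 2 - 2 * \<delta> * (2 * s + 1)\<close>, and
  \<open>2 * s + 1 \<le> 3 * t\<close> makes the subtracted term at most
  \<open>1 / 2\<close>.\<close>

lemma powr_estimate:
  fixes M x \<delta> D E :: real and s t :: nat
  assumes "1 \<le> x" "0 \<le> M" and \<delta>: "\<delta> = 1 / (12 * real t)" and st: "s \<le> t" "1 \<le> t"
    and D: "M * x powr (1 / 2 - 2 * \<delta>) \<le> D" and E: "M * x powr (3 / 2 - 2 * \<delta>) \<le> E"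
  shows "M ^ (2 * s + 1) * x ^ (2 * s + 1) \<le> D ^ s * E ^ (s + 1)"
proof -
  have pos: "0 \<le> M * x powr (1 / 2 - 2 * \<delta>)" "0 \<le> M * x powr (3 / 2 - 2 * \<delta>)"
    using assms(2) by simp_all
  have pw: "x powr (a * real k) = (x powr a) ^ k" for a k
    using assms(1) by (subst powr_powr[symmetric], subst powr_realpow) auto
  have Mp: "M ^ (2 * s + 1) = M ^ s * M ^ (s + 1)"
    by (simp only: mult_2 add.assoc power_add)
  have xp: "x powr real (2 * s + 1) = x ^ (2 * s + 1)"
    by (rule powr_realpow) (use assms(1) in simp)
  have "2 * s + 1 \<le> 3 * t" using st by linarith
  then have "real (2 * s + 1) \<le> real (3 * t)" by (rule of_nat_mono)
  then have "2 * \<delta> * real (2 * s + 1) \<le> 1 / 2"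
    using st by (simp add: \<delta> field_simps)
  then have "real (2 * s + 1) \<le> (1 / 2 - 2 * \<delta>) * real s + (3 / 2 - 2 * \<delta>) * real (s + 1)"
    by (simp add: field_simps)
  then have "x powr real (2 * s + 1) \<le> x powr ((1 / 2 - 2 * \<delta>) * real s + (3 / 2 - 2 * \<delta>) * real (s + 1))"
    using assms(1) by (rule powr_mono)
  also have "\<dots> = (x powr (1 / 2 - 2 * \<delta>)) ^ s * (x powr (3 / 2 - 2 * \<delta>)) ^ (s + 1)"
    unfolding powr_add pw ..
  finally have "M ^ (2 * s + 1) * x ^ (2 * s + 1)
      \<le> M ^ (2 * s + 1) * ((x powr (1 / 2 - 2 * \<delta>)) ^ s * (x powr (3 / 2 - 2 * \<delta>)) ^ (s + 1))"
    unfolding xp by (rule mult_left_mono) (use assms(2) in simp)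
  also have "\<dots> = (M * x powr (1 / 2 - 2 * \<delta>)) ^ s * (M * x powr (3 / 2 - 2 * \<delta>)) ^ (s + 1)"
    unfolding Mp power_mult_distrib by (simp only: mult_ac)
  also have "\<dots> \<le> D ^ s * E ^ (s + 1)"
    by (rule mult_mono[OF power_mono[OF D pos(1)] power_mono[OF E pos(2)]
          zero_le_power[OF order_trans[OF pos(1) D]] zero_le_power[OF pos(2)]])
  finally show ?thesis .
qed

theorem theorem4p2:
  fixes s t :: nat
  assumes "2 \<le> s" and "s \<le> t"
  shows "\<exists>C :: real. \<forall>n :: nat.
    real (ex_number n (subdivision (complete_bipartite s t)))
      \<le> C * real n powr (3 / 2 - 1 / (12 * real t))"
proof -
  define H where "H = subdivision (complete_bipartite s t)"
  define c where "c = 1 / real (2 * 4 ^ (s + t) * (s * t))"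
  define \<delta> where "\<delta> = 1 / (12 * real t)"
  \<comment> \<open>Chosen so that the number \<open>k + 1\<close> of dyadic classes is at most
    \<open>\<kappa> * x powr \<delta>\<close>, by
    \<open>ln x \<le> x powr \<delta> / \<delta>\<close>.\<close>
  define \<kappa> where "\<kappa> = 1 / (\<delta> * ln 2) + 1"
  define P where "P = 4 ^ (s + 1) * real (t * s * (s * t)) / c ^ (s + 1)"
  \<comment> \<open>\<open>M\<close> has to exceed \<open>P\<close> for the final contradiction and
    \<open>2 * 4 ^ (s + t)\<close> to rule out a small \<open>D\<close>.\<close>
  define M where "M = P + 2 * 4 ^ (s + t) + 1"
  define C where "C = 8 * \<kappa> * M"
  have cpos: "c > 0" using assms by (simp add: c_def)
  have dpos: "\<delta> > 0" using assms by (simp add: \<delta>_def)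
  have dle: "2 * \<delta> \<le> 1 / 2" using assms by (simp add: \<delta>_def field_simps)
  have kap: "\<kappa> \<ge> 1" using dpos by (simp add: \<kappa>_def)
  have Ppos: "P \<ge> 0" using cpos by (simp add: P_def)
  have M: "M \<ge> 1" "M > P" "M > 2 * 4 ^ (s + t)"
    using Ppos zero_le_power[of "4 :: real" "s + t"] unfolding M_def by linarith+
  have main: "real (card (edges G)) \<le> C * real n powr (3 / 2 - \<delta>)"
    if G: "finite_simple_graph G" "card (verts G) = n" "\<not> contains_copy G H" for G :: "nat graph" and n
  proof (cases "n = 0")
    case True
    then have "verts G = {}" using G by (auto simp: finite_simple_graph_def)
    then have "edges G = {}" using G(1) by (fastforce simp: finite_simple_graph_def)
    then show ?thesis using True by simp
  next
    case False
    define x where "x = real n"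
    have x: "1 \<le> x" using False by (simp add: x_def)
    obtain k where k: "2 ^ k \<le> n" "n < 2 ^ (k + 1)"
      using ex_power_ivl1[of 2 n] False by auto
    obtain D E where DE: "card (edges G) \<le> 8 * (k + 1) * E" "card (edges G) \<le> 8 * n * D"
      "D < 2 * 4 ^ (s + t) \<or> real D ^ s * (c * real E) ^ (s + 1)
        \<le> 4 ^ (s + 1) * real n ^ (2 * s + 1) * real (t * s * (s * t))"
    proof (rule edges_bound[OF G(1) G(3)[unfolded H_def] G(2) k(2) _ _ c_def])
      show "1 \<le> s" "2 \<le> t" using assms by linarith+
    qed
    have K: "real (k + 1) \<le> \<kappa> * x powr \<delta>"
    proof -
      have "real k * ln 2 = ln (2 ^ k)" by (simp add: ln_realpow)
      also have "\<dots> \<le> ln x" using of_nat_mono[OF k(1), where 'a = real] x by (simp add: x_def)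
      also have "\<dots> \<le> x powr \<delta> / \<delta>" by (rule ln_powr_bound[OF x dpos])
      finally have "real k \<le> x powr \<delta> / \<delta> / ln 2" by (subst pos_le_divide_eq) simp_all
      moreover have "1 \<le> x powr \<delta>" using x dpos by (simp add: ge_one_powr_ge_zero)
      ultimately show ?thesis by (simp add: \<kappa>_def algebra_simps)
    qed
    show ?thesis
    proof (rule ccontr)
      assume "\<not> ?thesis"
      then have e: "8 * \<kappa> * M * x powr (3 / 2 - \<delta>) < real (card (edges G))"
        by (simp add: C_def x_def)
      \<comment> \<open>Of the \<open>2 * \<delta>\<close> lost in the exponent for
        \<open>E\<close>, one \<open>\<delta>\<close> is in the bound being proved and the other
        pays for the logarithmic number of classes.\<close>
      have "M * x powr (3 / 2 - 2 * \<delta>) * (8 * (\<kappa> * x powr \<delta>)) = 8 * \<kappa> * M * x powr (3 / 2 - \<delta>)"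
        using x by (simp flip: powr_add)
      also note e
      also have "real (card (edges G)) \<le> real (8 * (k + 1) * E)" using DE(1) by (rule of_nat_mono)
      also have "\<dots> = real E * (8 * real (k + 1))" by simp
      also have "\<dots> \<le> real E * (8 * (\<kappa> * x powr \<delta>))" using K by (intro mult_left_mono) auto
      finally have "M * x powr (3 / 2 - 2 * \<delta>) < real E"
        by (rule mult_right_less_imp_less) (use kap in simp)
      then have E: "M * x powr (3 / 2 - 2 * \<delta>) \<le> real E" by (rule less_imp_le)
      \<comment> \<open>No logarithm enters here; the exponent is lowered to
        \<open>1 / 2 - 2 * \<delta>\<close> to match \<open>powr_estimate\<close>.\<close>
      have "M * x powr (1 / 2 - 2 * \<delta>) * (8 * x) \<le> \<kappa> * M * x powr (1 / 2 - \<delta>) * (8 * x)"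
        using M(1) kap x dpos by (intro mult_right_mono mult_mono powr_mono) auto
      also have "\<dots> = 8 * \<kappa> * M * (x powr (1 / 2 - \<delta>) * x powr 1)" using x by simp
      also have "\<dots> = 8 * \<kappa> * M * x powr (3 / 2 - \<delta>)"
        by (subst powr_add[symmetric]) (simp add: algebra_simps)
      also note e
      also have "real (card (edges G)) \<le> real (8 * n * D)" using DE(2) by (rule of_nat_mono)
      also have "\<dots> = real D * (8 * x)" by (simp add: x_def)
      finally have "M * x powr (1 / 2 - 2 * \<delta>) < real D"
        by (rule mult_right_less_imp_less) (use x in simp)
      then have D: "M * x powr (1 / 2 - 2 * \<delta>) \<le> real D" by (rule less_imp_le)
      \<comment> \<open>As \<open>2 * \<delta> \<le> 1 / 2\<close>, the power of \<open>x\<close> is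
        at least 1; so \<open>D\<close> exceeds \<open>2 * 4 ^ (s + t)\<close> and only the second
        alternative of \<open>edges_bound\<close> is left.\<close>
      have "M * 1 \<le> M * x powr (1 / 2 - 2 * \<delta>)"
        using M(1) x dle by (intro mult_left_mono ge_one_powr_ge_zero) auto
      then have "2 * 4 ^ (s + t) < real D" using M(3) D by linarith
      then have "real (2 * 4 ^ (s + t)) < real D" by simp
      then have "2 * 4 ^ (s + t) < D" by (simp only: of_nat_less_iff)
      then have "real D ^ s * (c * real E) ^ (s + 1)
          \<le> 4 ^ (s + 1) * real n ^ (2 * s + 1) * real (t * s * (s * t))"
        using DE(3) by linarith
      also have "\<dots> = P * c ^ (s + 1) * x ^ (2 * s + 1)" using cpos by (simp add: P_def x_def)
      finally have "real D ^ s * real E ^ (s + 1) * c ^ (s + 1) \<le> P * x ^ (2 * s + 1) * c ^ (s + 1)"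
        by (simp only: power_mult_distrib mult_ac)
      then have le: "real D ^ s * real E ^ (s + 1) \<le> P * x ^ (2 * s + 1)"
        by (rule mult_right_le_imp_le) (use cpos in simp)
      have "M ^ (2 * s + 1) * x ^ (2 * s + 1) \<le> real D ^ s * real E ^ (s + 1)"
        using x M(1) assms D E by (intro powr_estimate[OF _ _ \<delta>_def]) auto
      with le have "M ^ (2 * s + 1) * x ^ (2 * s + 1) \<le> P * x ^ (2 * s + 1)" by linarith
      then have "M ^ (2 * s + 1) \<le> P" by (rule mult_right_le_imp_le) (use x in simp)
      moreover have "M ^ 1 \<le> M ^ (2 * s + 1)" using M(1) by (intro power_increasing) auto
      ultimately show False using M(2) by simp
    qed
  qed
  \<comment> \<open>An edge of \<open>H\<close> makes edgeless graphs free of copies, so the set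
    under \<open>Max\<close> is nonempty for every \<open>n\<close> and its maximum is
    attained.\<close>
  have "{Inl 0, Inr 0} \<in> edges (complete_bipartite s t)"
    using assms by (simp add: complete_bipartite_def, intro exI[of _ 0]) auto
  then have "edges H \<noteq> {}" by (auto simp: H_def subdivision_def)
  have "real (ex_number n H) \<le> C * real n powr (3 / 2 - \<delta>)" for n
  proof -
    have "ex_number n H \<in> {card (edges G) | G :: nat graph.
        finite_simple_graph G \<and> card (verts G) = n \<and> \<not> contains_copy G H}"
      unfolding ex_number_def
      by (intro Max_in finite_ex_number_set ex_number_set_nonempty \<open>edges H \<noteq> {}\<close>)
    then obtain G :: "nat graph" where "finite_simple_graph G" "card (verts G) = n"
        "\<not> contains_copy G H" "ex_number n H = card (edges G)"
      by blast
    then show ?thesis using main by simp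
  qed
  then show ?thesis unfolding H_def \<delta>_def by blast
qed

end
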